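(* Let $n$ be a positive integer, and let $\mathbf{Y} = (Y_1, Y_2, \dots, Y_n)'$ be the random vector whose $j$th component $Y_j$ is the number of $j$-cycles of a uniformly random permutation in the symmetric group $\mathfrak{S}_n$. Let $\mathbf{\Sigma} = E(\mathbf{Y}\mathbf{Y}') - E(\mathbf{Y})E(\mathbf{Y}')$ be its $n\times n$ covariance matrix. Then the entries $\Sigma_{ij}$ ($1\le i,j\le n$) of $\mathbf{\Sigma}$ are given by $$\Sigma_{ij} = \begin{cases} 1/i, & \text{if } i=j \text{ and } i\le n/2,\\ (i-1)/i^2, & \text{if } i=j \text{ and } i>n/2,\\ 0, & \text{if } i<j \text{ and } j\le n-i,\\ -1/(ij), & \text{if } i<j \text{ and } j>n-i,\\ \Sigma_{ji}, & \text{if } i>j.\end{cases}$$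
   Context: The prime $'$ denotes transpose (vectors are column vectors). A permutation is chosen from $\mathfrak{S}_n$ with each permutation having probability $1/n!$; fixed points count as $1$-cycles, so $Y_j$ is the multiplicity of the part $j$ in the partition of $n$ given by the cycle type of the permutation. Equivalently, $\mathbf{Y}$ is supported on the vectors $(y_1,\dots,y_n)'$ of nonnegative integers with $y_1+2y_2+\cdots+ny_n=n$, and $$P\big(\mathbf{Y}=(y_1,\dots,y_n)'\big) = \frac{1}{1^{y_1}2^{y_2}\cdots n^{y_n}\, y_1!\,y_2!\cdots y_n!}.$$ *)

theory Defs
  imports
    "HOL-Combinatorics.Orbits"
    "HOL-Probability.Probability_Mass_Function"
    "Jordan_Normal_Form.Matrix"
begin

definition random_perm :: "nat \<Rightarrow> (nat \<Rightarrow> nat) pmf" where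
  "random_perm n = pmf_of_set {p. p permutes {1..n}}"

text \<open>
  The restriction to subsets of \<open>{1..n}\<close> is needed because a permutation of \<open>{1..n}\<close> is a
  function on all of \<open>nat\<close> that fixes every point outside \<open>{1..n}\<close>. A fixed point \<open>x\<close>
  satisfies \<open>cyclic_on p {x}\<close>, so it counts as a 1-cycle.
\<close>

definition cycle_count :: "nat \<Rightarrow> nat \<Rightarrow> (nat \<Rightarrow> nat) \<Rightarrow> nat" where
  "cycle_count n j p = card {C. C \<subseteq> {1..n} \<and> cyclic_on p C \<and> card C = j}"

text \<open>
  Column vectors are matrices with one column. Matrix indices start at 0, so the component
  \<open>Y\<^sub>j\<close> (the number of \<open>j\<close>-cycles) sits in row \<open>j - 1\<close>.
\<close>

definition cycle_vec :: "nat \<Rightarrow> (nat \<Rightarrow> nat) \<Rightarrow> real mat" where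
  "cycle_vec n p = mat n 1 (\<lambda>(i, _). real (cycle_count n (i + 1) p))"

definition expectation_mat :: "nat \<Rightarrow> nat \<Rightarrow> 'a pmf \<Rightarrow> ('a \<Rightarrow> real mat) \<Rightarrow> real mat" where
  "expectation_mat nr nc M X =
     mat nr nc (\<lambda>(i, j). measure_pmf.expectation M (\<lambda>\<omega>. X \<omega> $$ (i, j)))"

definition covariance_mat :: "nat \<Rightarrow> 'a pmf \<Rightarrow> ('a \<Rightarrow> real mat) \<Rightarrow> real mat" where
  "covariance_mat n M Y =
     expectation_mat n n M (\<lambda>\<omega>. Y \<omega> * transpose_mat (Y \<omega>))
     - expectation_mat n 1 M Y * expectation_mat 1 n M (\<lambda>\<omega>. transpose_mat (Y \<omega>))"

lemma covariance_mat_carrier: "covariance_mat n M Y \<in> carrier_mat n n"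
  unfolding covariance_mat_def expectation_mat_def
  by (rule minus_carrier_mat, rule mult_carrier_mat[where n = 1], rule mat_carrier, rule mat_carrier)

definition cycle_cov :: "nat \<Rightarrow> real mat" where
  "cycle_cov n = covariance_mat n (random_perm n) (cycle_vec n)"

definition entry :: "'a mat \<Rightarrow> nat \<Rightarrow> nat \<Rightarrow> 'a" where
  "entry A i j = A $$ (i - 1, j - 1)"

end

theory Submission
  imports Defs
begin

text \<open>
  Write \<open>Y\<^sub>j\<close> as the sum, over the \<open>j\<close>-element subsets \<open>C\<close> of \<open>{1..n}\<close>, of the indicator of the
  event that \<open>C\<close> is a cycle. Both moments then reduce to counting permutations with one or two
  prescribed cycles.

  A permutation with the cycle \<open>C\<close> is the same as a cyclic permutation of \<open>C\<close> together with an
  arbitrary permutation of the complement (\<open>card_permutes_with_cycle\<close>), and there are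
  \<open>(|C| - 1)!\<close> cyclic permutations of \<open>C\<close> (\<open>card_cyclic_permutes\<close>). Hence the total number of
  \<open>j\<close>-cycles in all permutations of an \<open>m\<close>-element set is \<open>(m choose j) (j - 1)! (m - j)! = m! / j\<close>
  for \<open>1 \<le> j \<le> m\<close>, and \<open>0\<close> for \<open>j > m\<close>; in particular \<open>E Y\<^sub>j = 1/j\<close>.

  Two distinct cycles of a permutation are disjoint. So, once an \<open>i\<close>-cycle \<open>C\<close> is prescribed, the
  \<open>j\<close>-cycles are \<open>C\<close> itself, if \<open>i = j\<close>, and the \<open>j\<close>-cycles of a uniformly random permutation of the
  remaining \<open>n - i\<close> points, whose expected number is \<open>1/j\<close> if \<open>i + j \<le> n\<close> and \<open>0\<close> otherwise. Therefore
  \<open>E (Y\<^sub>i Y\<^sub>j) = ([i = j] + [i + j \<le> n] / j) / i\<close>, and subtracting \<open>1 / (i j)\<close> gives all cases of the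
  covariance: if \<open>i + j \<le> n\<close> the product of the means cancels, otherwise it survives.
\<close>

section \<open>Permutations with prescribed cycles\<close>

text \<open>
  A permutation having \<open>C\<close> as a cycle preserves both \<open>C\<close> and its complement, so it factors uniquely
  as \<open>r \<circ> q\<close>, with \<open>r\<close> cyclic on \<open>C\<close> and \<open>q\<close> acting off \<open>C\<close>. The side condition \<open>Q\<close>, which may only
  look at \<open>q\<close>, makes it possible to prescribe a second cycle outside \<open>C\<close>.
\<close>

lemma card_permutes_with_cycle:
  assumes fin: "finite A" and sub: "C \<subseteq> A"
    and Q: "\<And>r q. r permutes C \<Longrightarrow> q permutes A - C \<Longrightarrow> Q (r \<circ> q) \<longleftrightarrow> Q q"
  shows "card {p. p permutes A \<and> cyclic_on p C \<and> Q p} =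
    card {r. r permutes C \<and> cyclic_on r C} * card {q. q permutes A - C \<and> Q q}"
proof -
  define R where "R = {r. r permutes C \<and> cyclic_on r C}"
  define T where "T = {q. q permutes A - C \<and> Q q}"
  define U where "U = {p. p permutes A \<and> cyclic_on p C \<and> Q p}"
  have "bij_betw (\<lambda>(r, q). r \<circ> q) (R \<times> T) U"
  proof (rule bij_betw_byWitness[where f' = "\<lambda>p. (perm_restrict p C, perm_restrict p (A - C))"])
    have restr: "perm_restrict (r \<circ> q) C = r" "perm_restrict (r \<circ> q) (A - C) = q"
      if "r permutes C" "q permutes A - C" for r q
    proof -
      have "r (q x) = r x" if "x \<in> C" for x
        using that permutes_not_in[OF \<open>q permutes A - C\<close>, of x] by simp
      moreover have "r (q x) = q x" if "x \<in> A - C" for x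
        using that permutes_not_in[OF \<open>r permutes C\<close>, of "q x"]
          permutes_in_image[OF \<open>q permutes A - C\<close>, of x] by simp
      ultimately show "perm_restrict (r \<circ> q) C = r" "perm_restrict (r \<circ> q) (A - C) = q"
        using permutes_not_in[OF \<open>r permutes C\<close>] permutes_not_in[OF \<open>q permutes A - C\<close>]
        by (auto simp: fun_eq_iff perm_restrict_def)
    qed
    then show "\<forall>rq\<in>R \<times> T. (\<lambda>p. (perm_restrict p C, perm_restrict p (A - C))) ((\<lambda>(r, q). r \<circ> q) rq) = rq"
      by (auto simp: R_def T_def)
    have comp: "perm_restrict p C \<circ> perm_restrict p (A - C) = p"
      if p: "p permutes A" "cyclic_on p C" for p
    proof -
      have "p x \<in> A - C" if "x \<in> A - C" for x
        using that p cyclic_on_f_in[OF p, of x] permutes_in_image[OF p(1), of x] by auto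
      then show ?thesis
        using permutes_not_in[OF p(1)] sub by (auto simp: fun_eq_iff perm_restrict_def)
    qed
    then show "\<forall>p\<in>U. (\<lambda>(r, q). r \<circ> q) (perm_restrict p C, perm_restrict p (A - C)) = p"
      by (auto simp: U_def)
    show "(\<lambda>(r, q). r \<circ> q) ` (R \<times> T) \<subseteq> U"
    proof clarify
      fix r q assume "r \<in> R" "q \<in> T"
      then have rq: "r permutes C" "cyclic_on r C" "q permutes A - C" "Q q"
        by (auto simp: R_def T_def)
      have "r \<circ> q permutes A"
        using rq sub by (intro permutes_compose) (auto intro: permutes_subset)
      moreover have "cyclic_on (r \<circ> q) C"
        using rq by (intro permutes_comp_preserves_cyclic1[where A = C and B = "A - C"]) auto
      ultimately show "r \<circ> q \<in> U"
        using Q[OF rq(1,3)] rq(4) by (simp add: U_def)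
    qed
    show "(\<lambda>p. (perm_restrict p C, perm_restrict p (A - C))) ` U \<subseteq> R \<times> T"
    proof clarify
      fix p assume "p \<in> U"
      then have p: "p permutes A" "cyclic_on p C" "Q p"
        by (auto simp: U_def)
      have "bij_betw p C C"
      proof -
        have "inj_on p C"
          using permutes_inj[OF p(1)] by (rule inj_on_subset) simp
        moreover have "p ` C = C"
          using \<open>inj_on p C\<close> cyclic_on_inI[OF p(2)] finite_subset[OF sub fin]
          by (intro endo_inj_surj) auto
        ultimately show ?thesis
          by (simp add: bij_betw_def)
      qed
      then have r: "perm_restrict p C permutes C"
        by (intro bij_imp_permutes)
          (auto simp: perm_restrict_simps cong: bij_betw_cong)
      moreover have "perm_restrict p (A - C) permutes A - C"
        using p by (intro perm_restrict_diff_cyclic)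
      ultimately show "perm_restrict p C \<in> R \<and> perm_restrict p (A - C) \<in> T"
        using Q[OF r, of "perm_restrict p (A - C)"] comp[OF p(1,2)] p(2,3)
        by (simp add: R_def T_def cyclic_on_perm_restrict)
    qed
  qed
  then have "card U = card (R \<times> T)"
    by (metis bij_betw_same_card)
  then show ?thesis
    by (simp add: R_def T_def U_def card_cartesian_product)
qed

lemma card_permutes_cyclic_on_subset:
  assumes "finite A" "C \<subseteq> A"
  shows "card {p. p permutes A \<and> cyclic_on p C} =
    card {r. r permutes C \<and> cyclic_on r C} * fact (card A - card C)"
  using card_permutes_with_cycle[OF assms, of "\<lambda>_. True"] assms
  by (simp add: card_permutations card_Diff_subset finite_subset)

lemma sum_Pow_card:
  fixes g :: "nat \<Rightarrow> nat"
  assumes "finite A"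
  shows "(\<Sum>B\<in>Pow A. g (card B)) = (\<Sum>k\<le>card A. (card A choose k) * g k)"
proof -
  have "(\<Sum>B\<in>Pow A. g (card B)) = (\<Sum>k\<le>card A. \<Sum>B\<in>{B \<in> Pow A. card B = k}. g (card B))"
    using assms by (intro sum.group[symmetric]) (auto intro: card_mono)
  also have "\<dots> = (\<Sum>k\<le>card A. (card A choose k) * g k)"
    using n_subsets[OF assms] by (intro sum.cong) auto
  finally show ?thesis .
qed

text \<open>
  Let \<open>c\<^sub>k\<close> be the number of cyclic permutations of a \<open>k\<close>-element set. Sorting all permutations of \<open>m + 1\<close>
  points by the cycle through a fixed point \<open>x\<close>, which is \<open>x\<close> together with a \<open>k\<close>-element
  subset of the other \<open>m\<close> points, gives \<open>(m + 1)! = (\<Sum>k\<le>m. (m choose k) c\<^bsub>k+1\<^esub> (m - k)!)\<close>.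
  This recursion determines the \<open>c\<^sub>k\<close>, and \<open>c\<^bsub>k+1\<^esub> = k!\<close> solves it because every summand is then \<open>m!\<close>.
\<close>

lemma card_cyclic_permutes:
  assumes "finite A" "A \<noteq> {}"
  shows "card {p. p permutes A \<and> cyclic_on p A} = fact (card A - 1)"
  using assms
proof (induction A rule: finite_psubset_induct)
  case (psubset A)
  define c where "c = (\<lambda>C::'a set. card {p. p permutes C \<and> cyclic_on p C})"
  obtain x where x: "x \<in> A"
    using psubset.prems by blast
  define A' where "A' = A - {x}"
  have A: "A = insert x A'" "x \<notin> A'" "finite A'"
    using x psubset.hyps by (auto simp: A'_def)
  define m where "m = card A'"
  have card_A: "card A = Suc m"
    using A by (simp add: m_def)
  \<comment> \<open>\<open>insert x B\<close> is the cycle through \<open>x\<close>.\<close>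
  have part: "{p. p permutes A} = (\<Union>B\<in>Pow A'. {p. p permutes A \<and> cyclic_on p (insert x B)})"
  proof (intro equalityI subsetI)
    fix p assume "p \<in> {p. p permutes A}"
    then have p: "p permutes A" by simp
    have cyc: "cyclic_on p (orbit p x)"
      using p psubset.hyps by (rule cyclic_on_orbit)
    have "x \<in> orbit p x"
      using p psubset.hyps by (intro permutation_self_in_orbit) (auto simp: permutation_permutes)
    then have "insert x (orbit p x - {x}) = orbit p x" by auto
    moreover have "orbit p x - {x} \<in> Pow A'"
      using permutes_orbit_subset[OF p x] by (auto simp: A'_def)
    ultimately show "p \<in> (\<Union>B\<in>Pow A'. {p. p permutes A \<and> cyclic_on p (insert x B)})"
      using p cyc by (intro UN_I[of "orbit p x - {x}"]) auto
  qed auto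
  have disj: "B = B'" if "B \<in> Pow A'" "B' \<in> Pow A'"
    "cyclic_on p (insert x B)" "cyclic_on p (insert x B')" for p B B'
  proof -
    have "insert x B = insert x B'"
      using orbit_cyclic_eq3[OF that(3), of x] orbit_cyclic_eq3[OF that(4), of x] by simp
    moreover have "x \<notin> B" "x \<notin> B'"
      using that A(2) by auto
    ultimately show ?thesis
      by (metis insert_ident)
  qed
  have "fact (Suc m) = card {p. p permutes A}"
    using card_permutations[OF card_A psubset.hyps] by simp
  also have "\<dots> = (\<Sum>B\<in>Pow A'. card {p. p permutes A \<and> cyclic_on p (insert x B)})"
    unfolding part
  proof (rule card_UN_disjoint)
    show "\<forall>B\<in>Pow A'. finite {p. p permutes A \<and> cyclic_on p (insert x B)}"
      using finite_permutations[OF psubset.hyps] by (auto intro: finite_subset[rotated])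
  qed (use A(3) disj in auto)
  also have "\<dots> = (\<Sum>B\<in>Pow A'. c (insert x B) * fact (m - card B))"
  proof (rule sum.cong)
    fix B assume "B \<in> Pow A'"
    then have "insert x B \<subseteq> A" "card (insert x B) = Suc (card B)"
      using A finite_subset[of B A'] by (auto simp: card_insert_if)
    then show "card {p. p permutes A \<and> cyclic_on p (insert x B)} = c (insert x B) * fact (m - card B)"
      using card_permutes_cyclic_on_subset[OF psubset.hyps, of "insert x B"]
      by (simp add: c_def card_A)
  qed simp
  \<comment> \<open>The subset \<open>A'\<close> contributes the unknown \<open>c A\<close>; all others fall under the induction hypothesis.\<close>
  also have "\<dots> = c A + (\<Sum>B\<in>Pow A' - {A'}. c (insert x B) * fact (m - card B))"
    using A by (subst sum.remove[of _ A']) (auto simp: m_def)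
  also have "(\<Sum>B\<in>Pow A' - {A'}. c (insert x B) * fact (m - card B)) =
      (\<Sum>B\<in>Pow A' - {A'}. fact (card B) * fact (m - card B))"
  proof (rule sum.cong)
    fix B assume B: "B \<in> Pow A' - {A'}"
    then have "insert x B \<subset> A" "card (insert x B) - 1 = card B"
      using A finite_subset[of B A'] by (auto simp: card_insert_if)
    then show "c (insert x B) * fact (m - card B) = fact (card B) * fact (m - card B)"
      using psubset.IH[of "insert x B"] by (simp add: c_def)
  qed simp
  finally have "fact (Suc m) = c A + (\<Sum>B\<in>Pow A' - {A'}. fact (card B) * fact (m - card B))" .
  moreover have "fact (Suc m) = fact m + (\<Sum>B\<in>Pow A' - {A'}. fact (card B) * fact (m - card B) :: nat)"
  proof -
    have "fact m + (\<Sum>B\<in>Pow A' - {A'}. fact (card B) * fact (m - card B) :: nat) =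
        (\<Sum>B\<in>Pow A'. fact (card B) * fact (m - card B))"
      using A by (subst sum.remove[of "Pow A'" A']) (auto simp: m_def)
    also have "\<dots> = (\<Sum>k\<le>m. (m choose k) * (fact k * fact (m - k)))"
      using sum_Pow_card[OF A(3), of "\<lambda>k. fact k * fact (m - k)"] by (simp add: m_def)
    also have "\<dots> = (\<Sum>k\<le>m. fact m)"
    proof (rule sum.cong)
      fix k assume "k \<in> {..m}"
      then show "(m choose k) * (fact k * fact (m - k)) = fact m"
        using binomial_fact_lemma[of k m] by (simp only: atMost_iff mult.commute)
    qed simp
    also have "\<dots> = fact (Suc m)" by simp
    finally show ?thesis by simp
  qed
  ultimately have "c A = fact m" by simp
  then show ?case by (simp add: c_def card_A)
qed

text \<open>
  The sum is the total number of \<open>j\<close>-cycles in all permutations of \<open>A\<close>, counted by cycle. It is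
  stated for arbitrary \<open>A\<close> because it is applied both to \<open>{1..n}\<close> and to the complement of
  a prescribed cycle; in the latter case \<open>j\<close> may exceed the size of the set.
\<close>

lemma sum_card_permutes_cyclic_on:
  assumes "finite A" "j \<ge> 1"
  shows "(\<Sum>D | D \<subseteq> A \<and> card D = j. real (card {p. p permutes A \<and> cyclic_on p D})) =
    (if j \<le> card A then fact (card A) / real j else 0)"
proof -
  have "(\<Sum>D | D \<subseteq> A \<and> card D = j. real (card {p. p permutes A \<and> cyclic_on p D})) =
    (\<Sum>D | D \<subseteq> A \<and> card D = j. fact (j - 1) * fact (card A - j))"
  proof (rule sum.cong)
    fix D assume "D \<in> {D. D \<subseteq> A \<and> card D = j}"
    then have D: "D \<subseteq> A" "card D = j" "D \<noteq> {}" "finite D"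
      using assms by (auto intro: finite_subset)
    show "real (card {p. p permutes A \<and> cyclic_on p D}) = fact (j - 1) * fact (card A - j)"
      using card_permutes_cyclic_on_subset[OF assms(1) D(1)] card_cyclic_permutes[OF D(4,3)] D(2)
      by simp
  qed simp
  also have "\<dots> = real (card A choose j) * (fact (j - 1) * fact (card A - j))"
    using n_subsets[OF assms(1), of j] by simp
  also have "\<dots> = (if j \<le> card A then fact (card A) / real j else 0)"
  proof (cases "j \<le> card A")
    case True
    have "fact j = real j * fact (j - 1)"
      using assms(2) by (simp add: fact_reduce)
    then show ?thesis
      using True assms(2) by (simp add: binomial_fact field_simps)
  qed (simp add: binomial_eq_0)
  finally show ?thesis .
qed

text \<open>
  A second cycle \<open>D\<close> that meets \<open>C\<close> equals \<open>C\<close>; this gives the first summand on the right. The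
  remaining \<open>D\<close> are cycles of the permutation induced on \<open>A - C\<close>, and the second summand is the
  average number of \<open>j\<close>-cycles of a permutation of that set.
\<close>

lemma sum_card_permutes_two_cycles:
  assumes "finite A" "C \<subseteq> A" "C \<noteq> {}" "j \<ge> 1"
  shows "(\<Sum>D | D \<subseteq> A \<and> card D = j. real (card {p. p permutes A \<and> cyclic_on p C \<and> cyclic_on p D})) =
    real (card {p. p permutes A \<and> cyclic_on p C}) *
      (of_bool (card C = j) + of_bool (card C + j \<le> card A) / real j)"
proof -
  define f where "f D = real (card {p. p permutes A \<and> cyclic_on p C \<and> cyclic_on p D})" for D
  define K where "K = {D. D \<subseteq> A \<and> card D = j}"
  define L where "L = {D. D \<subseteq> A - C \<and> card D = j}"
  have finC: "finite C" and finK: "finite K"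
    using assms by (auto simp: K_def intro: finite_subset)
  have zero: "f D = 0" if "D \<inter> C \<noteq> {}" "D \<noteq> C" for D
  proof -
    have "{p. p permutes A \<and> cyclic_on p C \<and> cyclic_on p D} = {}"
    proof -
      have "D = C" if "cyclic_on p C" "cyclic_on p D" for p
      proof -
        obtain x where "x \<in> D" "x \<in> C"
          using \<open>D \<inter> C \<noteq> {}\<close> by blast
        then show ?thesis
          using orbit_cyclic_eq3[OF that(1), of x] orbit_cyclic_eq3[OF that(2), of x] by simp
      qed
      then show ?thesis
        using \<open>D \<noteq> C\<close> by blast
    qed
    then show ?thesis unfolding f_def by (metis card.empty of_nat_0)
  qed
  have "sum f K = sum f (K \<inter> {C}) + sum f L"
  proof -
    have "(K \<inter> {C}) \<inter> L = {}" using assms(3) by (auto simp: L_def)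
    then have "sum f (K \<inter> {C}) + sum f L = sum f ((K \<inter> {C}) \<union> L)"
      using finK assms(1) by (intro sum.union_disjoint[symmetric]) (auto simp: L_def)
    also have "\<dots> = sum f K"
      using finK zero by (intro sum.mono_neutral_left) (auto simp: K_def L_def)
    finally show ?thesis by simp
  qed
  also have "sum f (K \<inter> {C}) = real (card {p. p permutes A \<and> cyclic_on p C}) * of_bool (card C = j)"
    using assms(2) by (auto simp: K_def f_def)
  also have "sum f L = (\<Sum>D\<in>L. real (card {r. r permutes C \<and> cyclic_on r C}) *
      real (card {q. q permutes A - C \<and> cyclic_on q D}))"
  proof (rule sum.cong)
    fix D assume "D \<in> L"
    then have D: "D \<subseteq> A - C" by (simp add: L_def)
    have "cyclic_on (r \<circ> q) D \<longleftrightarrow> cyclic_on q D" if "r permutes C" "q permutes A - C" for r q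
    proof (rule cyclic_cong)
      fix s assume "s \<in> D"
      then have "q s \<notin> C"
        using D permutes_in_image[OF that(2), of s] by auto
      then show "(r \<circ> q) s = q s"
        using permutes_not_in[OF that(1)] by simp
    qed
    then show "f D = real (card {r. r permutes C \<and> cyclic_on r C}) *
        real (card {q. q permutes A - C \<and> cyclic_on q D})"
      unfolding f_def using card_permutes_with_cycle[OF assms(1,2), of "\<lambda>p. cyclic_on p D"] by simp
  qed simp
  also have "\<dots> = real (card {r. r permutes C \<and> cyclic_on r C}) *
      (if j \<le> card (A - C) then fact (card (A - C)) / real j else 0)"
    unfolding L_def sum_distrib_left[symmetric]
    using sum_card_permutes_cyclic_on[of "A - C" j] assms by simp
  also have "\<dots> = real (card {p. p permutes A \<and> cyclic_on p C}) * (of_bool (card C + j \<le> card A) / real j)"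
    using card_permutes_cyclic_on_subset[OF assms(1,2)] assms finC card_mono[OF assms(1,2)]
    by (auto simp: card_Diff_subset)
  finally show ?thesis
    by (simp add: f_def K_def distrib_left)
qed

section \<open>Moments of the cycle counts\<close>

lemma expectation_random_perm:
  "measure_pmf.expectation (random_perm n) f = (\<Sum>p | p permutes {1..n}. f p) / fact n"
  for f :: "(nat \<Rightarrow> nat) \<Rightarrow> real"
proof -
  have "{p. p permutes {1..n}} \<noteq> {}" using permutes_id by blast
  then show ?thesis
    using card_permutations[of "{1..n}" n] finite_permutations[of "{1..n}"]
    by (simp add: random_perm_def integral_pmf_of_set)
qed

lemma cycle_count_eq_sum:
  "real (cycle_count n j p) = (\<Sum>C | C \<subseteq> {1..n} \<and> card C = j. of_bool (cyclic_on p C))"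
proof -
  have "{C. C \<subseteq> {1..n} \<and> cyclic_on p C \<and> card C = j} =
      {C. C \<subseteq> {1..n} \<and> card C = j} \<inter> {C. cyclic_on p C}" by auto
  then show ?thesis
    by (simp add: cycle_count_def sum_of_bool_eq)
qed

lemma expectation_cycle_count:
  assumes "j \<in> {1..n}"
  shows "measure_pmf.expectation (random_perm n) (\<lambda>p. real (cycle_count n j p)) = 1 / real j"
proof -
  have fin: "finite {p. p permutes {1..n}}"
    by (rule finite_permutations) simp
  have "(\<Sum>p | p permutes {1..n}. real (cycle_count n j p)) =
      (\<Sum>C | C \<subseteq> {1..n} \<and> card C = j. \<Sum>p | p permutes {1..n}. of_bool (cyclic_on p C))"
    unfolding cycle_count_eq_sum by (rule sum.swap)
  also have "\<dots> = (\<Sum>C | C \<subseteq> {1..n} \<and> card C = j. real (card {p. p permutes {1..n} \<and> cyclic_on p C}))"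
    using fin by (simp add: sum_of_bool_eq Collect_conj_eq)
  also have "\<dots> = fact n / real j"
    using sum_card_permutes_cyclic_on[of "{1..n}" j] assms by simp
  finally show ?thesis
    by (simp add: expectation_random_perm)
qed

lemma expectation_cycle_count_mult:
  assumes "i \<in> {1..n}" "j \<in> {1..n}"
  shows "measure_pmf.expectation (random_perm n)
      (\<lambda>p. real (cycle_count n i p) * real (cycle_count n j p)) =
    (of_bool (i = j) + of_bool (i + j \<le> n) / real j) / real i"
proof -
  let ?S = "\<lambda>k. {C. C \<subseteq> {1..n} \<and> card C = k}"
  have fin: "finite {p. p permutes {1..n}}"
    by (rule finite_permutations) simp
  have "(\<Sum>p | p permutes {1..n}. real (cycle_count n i p) * real (cycle_count n j p)) =
      (\<Sum>p | p permutes {1..n}. \<Sum>C\<in>?S i. \<Sum>D\<in>?S j. of_bool (cyclic_on p C \<and> cyclic_on p D))"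
    unfolding cycle_count_eq_sum sum_product by (simp only: of_bool_conj)
  also have "\<dots> = (\<Sum>C\<in>?S i. \<Sum>p | p permutes {1..n}. \<Sum>D\<in>?S j. of_bool (cyclic_on p C \<and> cyclic_on p D))"
    by (rule sum.swap)
  also have "\<dots> = (\<Sum>C\<in>?S i. \<Sum>D\<in>?S j. \<Sum>p | p permutes {1..n}. of_bool (cyclic_on p C \<and> cyclic_on p D))"
    by (intro sum.cong refl sum.swap)
  also have "\<dots> = (\<Sum>C\<in>?S i. \<Sum>D\<in>?S j.
      real (card {p. p permutes {1..n} \<and> cyclic_on p C \<and> cyclic_on p D}))"
    using fin by (simp add: sum_of_bool_eq Collect_conj_eq)
  also have "\<dots> = (\<Sum>C\<in>?S i. real (card {p. p permutes {1..n} \<and> cyclic_on p C}) *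
      (of_bool (i = j) + of_bool (i + j \<le> n) / real j))"
  proof (intro sum.cong refl)
    fix C assume "C \<in> ?S i"
    then have "C \<subseteq> {1..n}" "card C = i" "C \<noteq> {}"
      using assms by auto
    then show "(\<Sum>D\<in>?S j. real (card {p. p permutes {1..n} \<and> cyclic_on p C \<and> cyclic_on p D})) =
        real (card {p. p permutes {1..n} \<and> cyclic_on p C}) *
          (of_bool (i = j) + of_bool (i + j \<le> n) / real j)"
      using sum_card_permutes_two_cycles[of "{1..n}" C j] assms by simp
  qed
  also have "\<dots> = fact n / real i * (of_bool (i = j) + of_bool (i + j \<le> n) / real j)"
    unfolding sum_distrib_right[symmetric]
    using sum_card_permutes_cyclic_on[of "{1..n}" i] assms by simp
  finally show ?thesis
    by (simp add: expectation_random_perm)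
qed

lemma entry_cycle_cov:
  assumes "i \<in> {1..n}" "j \<in> {1..n}"
  shows "entry (cycle_cov n) i j =
    measure_pmf.expectation (random_perm n)
      (\<lambda>p. real (cycle_count n i p) * real (cycle_count n j p)) -
    measure_pmf.expectation (random_perm n) (\<lambda>p. real (cycle_count n i p)) *
    measure_pmf.expectation (random_perm n) (\<lambda>p. real (cycle_count n j p))"
proof -
  obtain k l where kl: "i = Suc k" "j = Suc l" "k < n" "l < n"
    using assms by (cases i; cases j) auto
  have prod: "(cycle_vec n p * transpose_mat (cycle_vec n p)) $$ (k, l) =
      real (cycle_count n i p) * real (cycle_count n j p)" for p
    using kl by (simp add: cycle_vec_def scalar_prod_def)
  show ?thesis
    unfolding entry_def cycle_cov_def covariance_mat_def expectation_mat_def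
    using kl by (simp add: prod[unfolded kl] scalar_prod_def) (simp add: cycle_vec_def)
qed

theorem corollary3p10:
  fixes n i j :: nat
  assumes "n \<ge> 1" and "i \<in> {1..n}" and "j \<in> {1..n}"
  shows "entry (cycle_cov n) i j =
    (if i = j \<and> real i \<le> real n / 2 then 1 / real i
     else if i = j \<and> real i > real n / 2 then (real i - 1) / (real i)\<^sup>2
     else if i < j \<and> j \<le> n - i then 0
     else if i < j \<and> j > n - i then - 1 / (real i * real j)
     else entry (cycle_cov n) j i)"
proof -
  have cov: "entry (cycle_cov n) k l = (of_bool (k = l) + of_bool (k + l \<le> n) / real l) / real k
      - 1 / real k * (1 / real l)" if "k \<in> {1..n}" "l \<in> {1..n}" for k l
    using that by (simp add: entry_cycle_cov expectation_cycle_count expectation_cycle_count_mult)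
  consider "i = j" | "i < j" | "i > j" by linarith
  then show ?thesis
  proof cases
    case 1
    have half: "real i \<le> real n / 2 \<longleftrightarrow> i + i \<le> n" by linarith
    have "1 / real i - 1 / real i * (1 / real i) = (real i - 1) / (real i)\<^sup>2"
      using assms by (simp add: field_simps power2_eq_square)
    moreover have "(1 + 1 / real i) / real i - 1 / real i * (1 / real i) = 1 / real i"
      by (simp add: add_divide_distrib)
    ultimately show ?thesis
      using 1 assms cov[of i i] half by simp
  next
    case 2
    then have "j \<le> n - i \<longleftrightarrow> i + j \<le> n" using assms by auto
    then show ?thesis
      using 2 assms cov[of i j] by (auto simp: field_simps)
  next
    case 3
    then show ?thesis
      using assms by (simp add: cov add.commute[of j i] mult.commute[of "real j"])
  qed
qed

end
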